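(* Let $\ell\ge 2$. For every $0\le i\le \ell$, the bivariate generating function $P^\star_i(z,q)$ of $[0,\dots,0,1,0,\dots,0]$-admissible colored partitions on $2\ell-1$ rows (with $k_i=1$ and $k_j=0$ for $j\ne i$) satisfies, as formal power series, $$P^\star_i(z,q)=\sum_{n_1,n_2,\dots,n_{\ell}\ge 0} \frac{z^{N_1}q^{N_1^2+N_2^2+\cdots+N_{\ell}^2+N_{i+1}+N_{i+2}+\cdots+N_{\ell}}}{(q;q)_{n_1}(q;q)_{n_2}\cdots(q;q)_{n_{\ell-1}}(q^2;q^2)_{n_{\ell}}},$$ where $N_m=n_m+n_{m+1}+\cdots+n_\ell$ (and the sum $N_{i+1}+\cdots+N_\ell$ is $0$ when $i=\ell$).
   Context: Notation: $(a;q)_n=\prod_{j=1}^n(1-aq^{j-1})$. Arrays on $2\ell-1$ rows, numbered $1,\dots,2\ell-1$ from top to bottom. In the odd-odd array, odd-numbered rows consist of the parts $1,3,5,\dots$ and even-numbered rows of the parts $2,4,6,\dots$. In the even-even array, odd-numbered rows consist of the parts $2,4,6,\dots$ and even-numbered rows of the parts $1,3,5,\dots$. Parts of equal size in different rows are regarded as distinct (differently colored). A colored partition is a finite multiset of parts of the array; its weight is the sum of the sizes of its parts and its number of parts is counted with multiplicity. The frequency of a part (a given size in a given row) is the number of times it occurs. Extended frequency arrays. Given nonnegative integers $k_0,\dots,k_\ell$, place in each row, at horizontal position $s$, the frequency of the part of size $s$ in that row. In addition each row of odd parts gets one extra entry at position $-1$ and each row of even parts gets one extra entry at position $0$: - odd-odd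 array: for odd $r\le\ell$ the entry at position $-1$ of row $r$ is $k_r$; all other extra entries are $0$ (placeholders); - even-even array: the entry at position $0$ of row $1$ is $k_0$; for even $r$ with $2\le r\le \ell$ the entry at position $-1$ of row $r$ is $k_r$; all other extra entries are $0$ (placeholders). A downward path is a choice of one entry in each row such that the positions of the entries in any two consecutive rows differ by exactly $1$ (extra entries are allowed). With $k=\sum_m k_m$, a colored partition is $[k_0,\dots,k_\ell]$-admissible if the sum of the entries on every downward path of its extended frequency array is at most $k$. For $0\le i\le\ell$, let $F^\star(i,j,n)$ be the number of colored partitions of weight $n$ with exactly $j$ parts that are $[k_0,\dots,k_\ell]$-admissible for $k_i=1$ and all other $k_m=0$ (so $k=1$), using the odd-odd array if $i$ is odd and the even-even array if $i$ is even. Let $P^\star_i(z,q)=\sum_{n,j\ge0}F^\star(i,j,n)z^jq^n$. *)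

theory Defs
  imports
    "HOL-Library.Multiset"
    "HOL-Library.FuncSet"
    "HOL-Computational_Algebra.Formal_Power_Series"
    "HOL-Analysis.Infinite_Sum"
begin

definition qpoch :: "'a::comm_ring_1 \<Rightarrow> 'a \<Rightarrow> nat \<Rightarrow> 'a" where
  "qpoch a q n = (\<Prod>j=1..n. 1 - a * q ^ (j - 1))"

text \<open>The two arrays; the name gives the parity of the parts in the first and in the last row.\<close>

datatype part_array = Odd_Odd | Even_Even

fun odd_row :: "part_array \<Rightarrow> nat \<Rightarrow> bool" where
  "odd_row Odd_Odd r \<longleftrightarrow> odd r"
| "odd_row Even_Even r \<longleftrightarrow> even r"

text \<open>A part is a pair (row, size), so that equal sizes in different rows are distinct.\<close>

definition parts :: "part_array \<Rightarrow> nat \<Rightarrow> (nat \<times> nat) set" where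
  "parts A l = {(r, s). r \<in> {1..2 * l - 1} \<and> 1 \<le> s \<and> (odd s \<longleftrightarrow> odd_row A r)}"

definition colored_partitions :: "part_array \<Rightarrow> nat \<Rightarrow> (nat \<times> nat) multiset set" where
  "colored_partitions A l = {\<pi>. set_mset \<pi> \<subseteq> parts A l}"

definition weight :: "(nat \<times> nat) multiset \<Rightarrow> nat" where
  "weight \<pi> = (\<Sum>(r, s)\<in>#\<pi>. s)"

text \<open>The extra entry of row \<open>r\<close>, at position \<open>- 1\<close> in rows of odd parts and at
  position \<open>0\<close> in rows of even parts.\<close>

fun extra_entry :: "part_array \<Rightarrow> nat \<Rightarrow> (nat \<Rightarrow> nat) \<Rightarrow> nat \<Rightarrow> nat" where
  "extra_entry Odd_Odd l k r = (if odd r \<and> r \<le> l then k r else 0)"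
| "extra_entry Even_Even l k r =
     (if r = 1 then k 0 else if even r \<and> 2 \<le> r \<and> r \<le> l then k r else 0)"

definition positions :: "part_array \<Rightarrow> nat \<Rightarrow> int set" where
  "positions A r = (if odd_row A r then {s. odd s \<and> - 1 \<le> s} else {s. even s \<and> 0 \<le> s})"

text \<open>Positions \<open>s \<le> 0\<close> are those of the extra entries.\<close>

definition entry ::
  "part_array \<Rightarrow> nat \<Rightarrow> (nat \<Rightarrow> nat) \<Rightarrow> (nat \<times> nat) multiset \<Rightarrow> nat \<Rightarrow> int \<Rightarrow> nat" where
  "entry A l k \<pi> r s = (if 1 \<le> s then count \<pi> (r, nat s) else extra_entry A l k r)"

definition downward_path :: "part_array \<Rightarrow> nat \<Rightarrow> (nat \<Rightarrow> int) \<Rightarrow> bool" where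
  "downward_path A l p \<longleftrightarrow>
     (\<forall>r\<in>{1..2 * l - 1}. p r \<in> positions A r) \<and>
     (\<forall>r\<in>{1..<2 * l - 1}. \<bar>p (r + 1) - p r\<bar> = 1)"

definition admissible ::
  "part_array \<Rightarrow> nat \<Rightarrow> (nat \<Rightarrow> nat) \<Rightarrow> (nat \<times> nat) multiset \<Rightarrow> bool" where
  "admissible A l k \<pi> \<longleftrightarrow>
     (\<forall>p. downward_path A l p \<longrightarrow>
        (\<Sum>r=1..2 * l - 1. entry A l k \<pi> r (p r)) \<le> (\<Sum>m=0..l. k m))"

definition array_of :: "nat \<Rightarrow> part_array" where
  "array_of i = (if odd i then Odd_Odd else Even_Even)"

definition F_star :: "nat \<Rightarrow> nat \<Rightarrow> nat \<Rightarrow> nat \<Rightarrow> nat" where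
  "F_star l i j n = card {\<pi> \<in> colored_partitions (array_of i) l.
     weight \<pi> = n \<and> size \<pi> = j \<and>
     admissible (array_of i) l (\<lambda>m. if m = i then 1 else 0) \<pi>}"

lemma finite_colored_partitions:
  "finite {\<pi> \<in> colored_partitions A l. weight \<pi> = n \<and> size \<pi> = j}"
proof (rule finite_subset)
  let ?B = "{1..2 * l - 1} \<times> {..n}"
  show "finite (multisets_of_size ?B j)"
    by (rule finite_multisets_of_size) auto
  show "{\<pi> \<in> colored_partitions A l. weight \<pi> = n \<and> size \<pi> = j} \<subseteq> multisets_of_size ?B j"
  proof
    fix \<pi> assume *: "\<pi> \<in> {\<pi> \<in> colored_partitions A l. weight \<pi> = n \<and> size \<pi> = j}"
    have "x \<in> ?B" if x: "x \<in># \<pi>" for x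
    proof -
      obtain \<sigma> where \<sigma>: "\<pi> = add_mset x \<sigma>" using x by (metis multi_member_split)
      then have "snd x \<le> n" using * by (auto simp: weight_def split: prod.splits)
      moreover have "fst x \<in> {1..2 * l - 1}"
        using * x by (force simp: colored_partitions_def parts_def)
      ultimately show ?thesis by (cases x) auto
    qed
    then show "\<pi> \<in> multisets_of_size ?B j" using * by (auto simp: multisets_of_size_def)
  qed
qed

text \<open>Bivariate series are power series in \<open>z\<close> (the outer \<open>fps\<close>) whose coefficients are power
  series in \<open>q\<close> (the inner \<open>fps\<close>). Convergence of sums is in the metric of the outer \<open>fps\<close>, which
  is \<open>z\<close>-adic.\<close>

definition P_star :: "nat \<Rightarrow> nat \<Rightarrow> rat fps fps" where
  "P_star l i = Abs_fps (\<lambda>j. Abs_fps (\<lambda>n. of_nat (F_star l i j n)))"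

abbreviation z_var :: "rat fps fps" where "z_var \<equiv> fps_X"
abbreviation q_var :: "rat fps" where "q_var \<equiv> fps_X"

definition N_tail :: "nat \<Rightarrow> (nat \<Rightarrow> nat) \<Rightarrow> nat \<Rightarrow> nat" where
  "N_tail l n m = (\<Sum>t=m..l. n t)"

text \<open>The denominator has constant coefficient 1, so the division is multiplication by its
  inverse power series.\<close>

definition summand :: "nat \<Rightarrow> nat \<Rightarrow> (nat \<Rightarrow> nat) \<Rightarrow> rat fps fps" where
  "summand l i n =
     z_var ^ N_tail l n 1 *
     fps_const (q_var ^ ((\<Sum>m=1..l. (N_tail l n m)\<^sup>2) + (\<Sum>m=i+1..l. N_tail l n m)) /
       ((\<Prod>m=1..l-1. qpoch q_var q_var (n m)) * qpoch (q_var\<^sup>2) (q_var\<^sup>2) (n l)))"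

end

theory Submission
  imports Defs
begin

text \<open>Since \<open>k = 1\<close>, admissibility only says that no two parts lie on a common downward path, that
  is, \<open>\<bar>s - s'\<bar> > \<bar>r - r'\<bar>\<close> for any two parts \<open>(r, s)\<close> and \<open>(r', s')\<close>, and that the same holds for a
  virtual part \<open>- 1\<close> in row \<open>i\<close>. Removing the smallest part and shifting the others down shows that
  the generating functions \<open>H\<^sub>j\<^sup>i\<close> for \<open>j\<close> parts satisfy
  \<open>(1 - q\<^bsup>2j\<^esup>) H\<^sub>j\<^sup>i = q\<^bsup>2j-1\<^esup> \<Sum>\<^sub>r q\<^bsup>j\<bar>r-i\<bar>\<^esup> H\<^sub>j\<^sub>-\<^sub>1\<^sup>r\<close>.
  With \<open>H\<^sub>j\<^sup>i = q\<^bsup>j*j\<^esup> S\<^sub>j\<^sup>i\<close> and the tridiagonal inverse of the matrix \<open>q\<^bsup>j\<bar>r-i\<bar>\<^esup>\<close> this is equivalent to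
  \<open>(1 + q\<^bsup>2j\<^esup>) S\<^sub>j\<^sup>i - q\<^bsup>j\<^esup> (S\<^sub>j\<^bsup>i-1\<^esup> + S\<^sub>j\<^bsup>i+1\<^esup>) = S\<^sub>j\<^sub>-\<^sub>1\<^sup>i\<close> with reflecting boundary
  conditions. The inner multisums satisfy the same three-term recurrence by induction on \<open>l\<close>: the
  transform \<open>f \<mapsto> \<Sum>\<^sub>N q\<^bsup>N*N\<^esup> f\<^sub>N / (q;q)\<^sub>j\<^sub>-\<^sub>N\<close> that adds one summation variable preserves it.\<close>

subsection \<open>The three-term recurrence of the multisums\<close>

text \<open>With \<open>a = q ^ N\<close> and \<open>b = q ^ (Suc j - N)\<close>, the hypothesis on
  \<open>g\<close> turns the coefficient of \<open>f N\<close> into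
  \<open>(1 - b) * (1 - a * a * b)\<close>. The factor \<open>1 - b\<close> lowers the index of
  \<open>c\<close>, and the \<open>f (N - 1)\<close> term, shifted by one, cancels the part with
  \<open>a * a * b\<close>. In the applications \<open>g\<close> is the sum of the two neighbours of
  \<open>f\<close>.\<close>

lemma multisum_transform_recurrence:
  fixes q :: "'a::comm_ring_1"
  assumes c: "\<And>n. c (Suc n) * (1 - q ^ Suc n) = c n"
    and fg: "\<And>N. q ^ N * g N = (1 + q ^ (2 * N)) * f N - (if N = 0 then 0 else f (N - 1))"
  shows "(1 + q ^ (2 * Suc j)) * (\<Sum>N\<le>Suc j. q ^ N\<^sup>2 * c (Suc j - N) * f N)
       - q ^ Suc j * (\<Sum>N\<le>Suc j. q ^ N\<^sup>2 * c (Suc j - N) * g N)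
       = (\<Sum>N\<le>j. q ^ N\<^sup>2 * c (j - N) * f N)"
proof -
  let ?J = "Suc j"
  let ?A = "\<lambda>N. q ^ N\<^sup>2 * (c (?J - N) * (1 - q ^ (?J - N))) * (1 - q ^ (?J + N)) * f N"
  let ?B = "\<lambda>N. q ^ N\<^sup>2 * c (?J - N) * q ^ (?J - N) * (if N = 0 then 0 else f (N - 1))"
  have summand_eq: "(1 + q ^ (2 * ?J)) * (q ^ N\<^sup>2 * c (?J - N) * f N)
      - q ^ ?J * (q ^ N\<^sup>2 * c (?J - N) * g N) = ?A N + ?B N" if "N \<le> ?J" for N
  proof -
    define k p d a b f' where "k = ?J - N" and "p = q ^ N\<^sup>2" and "d = c k"
      and "a = q ^ N" and "b = q ^ k" and "f' = (if N = 0 then 0 else f (N - 1))"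
    have J: "q ^ ?J = b * a" "q ^ (2 * ?J) = (b * a) * (b * a)" "q ^ (?J + N) = b * a * a"
      using that by (simp_all add: a_def b_def k_def mult_2 del: power_Suc flip: power_add)
    have "a * g N = (1 + a * a) * f N - f'"
      using fg[of N] by (simp add: a_def f'_def mult_2 power_add)
    then have "b * a * (p * d * g N) = p * d * b * ((1 + a * a) * f N - f')"
      by (metis (no_types, lifting) mult.assoc mult.commute)
    then show ?thesis
      unfolding J k_def[symmetric] p_def[symmetric] d_def[symmetric] b_def[symmetric]
        f'_def[symmetric]
      by (simp add: algebra_simps)
  qed
  have "?A N = q ^ N\<^sup>2 * c (j - N) * (1 - q ^ (?J + N)) * f N" if "N \<le> j" for N
    using c[of "j - N"] that by (simp add: Suc_diff_le)
  then have A: "(\<Sum>N\<le>?J. ?A N) = (\<Sum>N\<le>j. q ^ N\<^sup>2 * c (j - N) * (1 - q ^ (?J + N)) * f N)"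
    by simp
  have "?B (Suc N) = q ^ N\<^sup>2 * c (j - N) * q ^ (?J + N) * f N" if "N \<le> j" for N
  proof -
    have "(Suc N)\<^sup>2 + (?J - Suc N) = N\<^sup>2 + (?J + N)"
      using that by (simp add: power2_eq_square)
    then have "q ^ (Suc N)\<^sup>2 * q ^ (?J - Suc N) = q ^ N\<^sup>2 * q ^ (?J + N)"
      by (metis power_add)
    then show ?thesis
      by (simp add: ac_simps)
  qed
  then have B: "(\<Sum>N\<le>?J. ?B N) = (\<Sum>N\<le>j. q ^ N\<^sup>2 * c (j - N) * q ^ (?J + N) * f N)"
    by (subst sum.atMost_Suc_shift) simp
  have "(1 + q ^ (2 * ?J)) * (\<Sum>N\<le>?J. q ^ N\<^sup>2 * c (?J - N) * f N)
       - q ^ ?J * (\<Sum>N\<le>?J. q ^ N\<^sup>2 * c (?J - N) * g N) = (\<Sum>N\<le>?J. ?A N + ?B N)"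
    unfolding sum_distrib_left sum_subtractf[symmetric] using summand_eq by (intro sum.cong) auto
  also have "\<dots> = (\<Sum>N\<le>j. q ^ N\<^sup>2 * c (j - N) * f N)"
    unfolding sum.distrib unfolding A B unfolding sum.distrib[symmetric]
    by (intro sum.cong) (auto simp: algebra_simps)
  finally show ?thesis .
qed

text \<open>The matrix \<open>a ^ \<bar>r - i\<bar>\<close> is inverse to a tridiagonal one, up to the boundary rows.\<close>

lemma tridiagonal_inversion:
  fixes a :: "'a::comm_ring_1"
  assumes "u 0 = a * u 1" and "u m = a * u (m - 1)" and "i < m"
  shows "(\<Sum>r=1..<m. a ^ nat \<bar>int r - int i\<bar> * ((1 + a\<^sup>2) * u r - a * (u (r - 1) + u (r + 1))))
       = (1 - a\<^sup>2) * u i"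
proof -
  let ?t = "\<lambda>r. (1 + a\<^sup>2) * u r - a * (u (r - 1) + u (r + 1))"
  \<comment> \<open>With \<open>v r = u r - a * u (r + 1)\<close> the term \<open>?t r\<close> is
    \<open>v r - a * v (r - 1)\<close>, so the weighted sum telescopes; \<open>v 0 = 0\<close> by
    the boundary condition.\<close>
  have left: "(\<Sum>r=1..<Suc k. a ^ (k - r) * ?t r) = u k - a * u (k + 1)" for k
  proof (induction k)
    case (Suc k)
    have "(\<Sum>r=1..<Suc k. a ^ (Suc k - r) * ?t r) = a * (\<Sum>r=1..<Suc k. a ^ (k - r) * ?t r)"
      unfolding sum_distrib_left by (intro sum.cong) (auto simp: Suc_diff_le ac_simps)
    then show ?case
      unfolding Suc.IH by (simp add: algebra_simps power2_eq_square)
  qed (simp add: assms)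
  \<comment> \<open>Mirror image: \<open>?t r = w r - a * w (r + 1)\<close> for
    \<open>w r = u r - a * u (r - 1)\<close>. At \<open>i + 1 + k = m\<close> the last term
    vanishes, since \<open>w m = 0\<close>.\<close>
  have right: "(\<Sum>r=i+1..<i+1+k. a ^ (r - i) * ?t r)
      = a * (u (i + 1) - a * u i) - a ^ (k + 1) * (u (i + 1 + k) - a * u (i + k))" for k
    by (induction k) (auto simp: algebra_simps power2_eq_square)
  have split: "{1..<m} = {1..<Suc i} \<union> {i+1..<m}" using assms by auto
  have "nat \<bar>int r - int i\<bar> = i - r" if "r < Suc i" for r using that by linarith
  then have L: "(\<Sum>r=1..<Suc i. a ^ nat \<bar>int r - int i\<bar> * ?t r)
      = (\<Sum>r=1..<Suc i. a ^ (i - r) * ?t r)"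
    by (intro sum.cong) auto
  have "nat \<bar>int r - int i\<bar> = r - i" if "i + 1 \<le> r" for r using that by linarith
  then have R: "(\<Sum>r=i+1..<m. a ^ nat \<bar>int r - int i\<bar> * ?t r)
      = (\<Sum>r=i+1..<m. a ^ (r - i) * ?t r)"
    by (intro sum.cong) auto
  have "(\<Sum>r=1..<m. a ^ nat \<bar>int r - int i\<bar> * ?t r)
      = (\<Sum>r=1..<Suc i. a ^ (i - r) * ?t r) + (\<Sum>r=i+1..<m. a ^ (r - i) * ?t r)"
    unfolding split unfolding L[symmetric] R[symmetric] by (rule sum.union_disjoint) auto
  also have "{i+1..<m} = {i+1..<i+1+(m-i-1)}" using assms by auto
  also have "(\<Sum>r=1..<Suc i. a ^ (i - r) * ?t r)
      + (\<Sum>r=i+1..<i+1+(m-i-1). a ^ (r - i) * ?t r)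
      = u i - a * u (i + 1) + a * (u (i + 1) - a * u i)"
    unfolding left right using assms by simp
  finally show ?thesis by (simp add: algebra_simps power2_eq_square)
qed

section \<open>Reciprocal q-Pochhammer symbols and the multisums\<close>

definition euler_recip :: "nat \<Rightarrow> rat fps" where
  "euler_recip n = inverse (qpoch q_var q_var n)"

definition euler_recip2 :: "nat \<Rightarrow> rat fps" where
  "euler_recip2 n = inverse (qpoch (q_var\<^sup>2) (q_var\<^sup>2) n)"

lemma qpoch_q_Suc: "qpoch q q (Suc n) = qpoch q q n * (1 - q ^ Suc n)"
  by (simp add: qpoch_def)

lemma fps_prod_nth_0: "fps_nth (prod f A) 0 = (\<Prod>x\<in>A. fps_nth (f x) 0)"
  for f :: "'b \<Rightarrow> 'a::comm_ring_1 fps"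
  by (induction A rule: infinite_finite_induct) auto

lemma qpoch_nth_0: "fps_nth a 0 = 0 \<Longrightarrow> fps_nth (qpoch a q n) 0 = 1" for a :: "'a::comm_ring_1 fps"
  by (simp add: qpoch_def fps_prod_nth_0)

lemma inverse_qpoch_q_Suc:
  fixes q :: "'a::field fps"
  assumes "fps_nth q 0 = 0"
  shows "inverse (qpoch q q (Suc n)) * (1 - q ^ Suc n) = inverse (qpoch q q n)"
proof -
  have *: "fps_nth (1 - q ^ Suc n) 0 \<noteq> 0"
    using assms by (simp add: fps_power_zeroth)
  show ?thesis
    unfolding qpoch_q_Suc using inverse_mult_eq_1[OF *]
    by (simp add: fps_inverse_mult mult.assoc)
qed

lemma euler_recip_Suc: "euler_recip (Suc n) * (1 - q_var ^ Suc n) = euler_recip n"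
  unfolding euler_recip_def by (rule inverse_qpoch_q_Suc) simp

lemma euler_recip2_Suc: "euler_recip2 (Suc n) * (1 - q_var ^ (2 * Suc n)) = euler_recip2 n"
  unfolding euler_recip2_def power_mult by (rule inverse_qpoch_q_Suc) simp

text \<open>The coefficient of \<open>z ^ j\<close> on the right-hand side, up to the factor \<open>q ^ j\<^sup>2\<close>, for
  \<open>l = d + 1\<close>. Truncated subtraction in \<open>i - 1\<close> is intended: once the linear exponents set in
  they persist for all later summation variables.\<close>

fun multisum :: "nat \<Rightarrow> nat \<Rightarrow> nat \<Rightarrow> rat fps" where
  "multisum 0 i j = (if i = 0 then q_var ^ j else 1) * euler_recip2 j"
| "multisum (Suc d) i j = (if i = 0 then q_var ^ j else 1) *
     (\<Sum>N\<le>j. q_var ^ N\<^sup>2 * euler_recip (j - N) * multisum d (i - 1) N)"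

lemma multisum_Suc_Suc: "multisum (Suc d) (Suc i) j =
    (\<Sum>N\<le>j. q_var ^ N\<^sup>2 * euler_recip (j - N) * multisum d i N)"
  by simp

text \<open>The truncated \<open>i - 1\<close> is 0 for \<open>i = 0\<close> and for
  \<open>i = 1\<close>, so only the outermost linear factor differs. This is the boundary condition
  needed in \<open>tridiagonal_inversion\<close>.\<close>

lemma multisum_i_0: "multisum d 0 j = q_var ^ j * multisum d 1 j"
  by (cases d) simp_all

lemma multisum_j_0: "multisum d i 0 = 1"
  by (induction d arbitrary: i) (auto simp: euler_recip_def euler_recip2_def qpoch_def)

lemma multisum_recurrence:
  assumes "1 \<le> i" and "i \<le> d"
  shows "(1 + q_var ^ (2 * Suc j)) * multisum d i (Suc j)
      - q_var ^ Suc j * (multisum d (i - 1) (Suc j) + multisum d (i + 1) (Suc j)) = multisum d i j"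
  using assms
proof (induction d arbitrary: i j)
  case (Suc d)
  show ?case
  proof (cases "i = 1")
    case True
    let ?f = "\<lambda>j i N. q_var ^ N\<^sup>2 * euler_recip (j - N) * multisum d i N"
    \<comment> \<open>By \<open>multisum_i_0\<close> the case \<open>i = 1\<close> reduces to the
      shorter identity \<open>*\<close>. Inside the sums the same relation turns
      \<open>q_var ^ Suc j\<close> on row 1 into \<open>q_var ^ (Suc j - N)\<close> on row 0, and
      the resulting factor lowers the index of \<open>euler_recip\<close>.\<close>
    have "?f (Suc j) 0 N - q_var ^ Suc j * ?f (Suc j) 1 N =
        q_var ^ N\<^sup>2 * (euler_recip (Suc j - N) * (1 - q_var ^ (Suc j - N))) * multisum d 0 N"
      if "N \<le> Suc j" for N
    proof -
      have "q_var ^ Suc j = q_var ^ (Suc j - N) * q_var ^ N"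
        using that by (simp del: power_Suc flip: power_add)
      then show ?thesis
        unfolding multisum_i_0 by (simp only:) (simp only: algebra_simps mult_1)
    qed
    then have "(\<Sum>N\<le>Suc j. ?f (Suc j) 0 N) - q_var ^ Suc j * (\<Sum>N\<le>Suc j. ?f (Suc j) 1 N)
      = (\<Sum>N\<le>Suc j. q_var ^ N\<^sup>2 * (euler_recip (Suc j - N) * (1 - q_var ^ (Suc j - N))) * multisum d 0 N)"
      unfolding sum_distrib_left sum_subtractf[symmetric] by (intro sum.cong) auto
    also have "\<dots> = (\<Sum>N\<le>j. ?f j 0 N)"
      using euler_recip_Suc by (auto simp: Suc_diff_le intro!: sum.cong)
    finally have *: "multisum (Suc d) 1 (Suc j) - q_var ^ Suc j * multisum (Suc d) 2 (Suc j)
        = multisum (Suc d) 1 j"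
      by (simp add: numeral_2_eq_2)
    have "q_var ^ (2 * Suc j) = q_var ^ Suc j * q_var ^ Suc j"
      by (simp add: mult_2 power_add)
    with * show ?thesis
      unfolding True diff_self_eq_0 multisum_i_0[of "Suc d"] one_add_one
      by (simp only: algebra_simps mult_1)
  next
    case False
    \<comment> \<open>At \<open>N = 0\<close> all multisums are 1 and both sides equal 2, so 0 is
      the right value for the missing predecessor.\<close>
    have IH: "q_var ^ N * (multisum d (i - 1 - 1) N + multisum d (i - 1 + 1) N) =
       (1 + q_var ^ (2 * N)) * multisum d (i - 1) N - (if N = 0 then 0 else multisum d (i - 1) (N - 1))" for N
    proof (cases N)
      case (Suc n)
      show ?thesis
        using Suc.IH[of "i - 1" n] Suc.prems False Suc by (simp add: algebra_simps)
    qed (simp add: multisum_j_0)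
    show ?thesis
      using multisum_transform_recurrence[OF euler_recip_Suc IH, of j] Suc.prems False
      by (simp add: algebra_simps sum.distrib)
  qed
qed simp

text \<open>The middle row, whose two neighbours coincide after folding. For \<open>d = 0\<close>
  the left side collapses to \<open>(1 - q_var ^ (2 * Suc j)) * euler_recip2 (Suc j)\<close>; this
  is where the base \<open>q_var\<^sup>2\<close> of the last denominator enters.\<close>

lemma multisum_recurrence_reflected:
  "(1 + q_var ^ (2 * Suc j)) * multisum d (Suc d) (Suc j)
      - q_var ^ Suc j * (multisum d d (Suc j) + multisum d d (Suc j)) = multisum d (Suc d) j"
proof (induction d arbitrary: j)
  case 0
  have "q_var ^ (2 * Suc j) = q_var ^ Suc j * q_var ^ Suc j"
    by (simp only: mult_2 power_add)
  then show ?case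
    using euler_recip2_Suc[of j] by (simp add: algebra_simps)
next
  case (Suc d)
  have IH: "q_var ^ N * (multisum d d N + multisum d d N) = (1 + q_var ^ (2 * N)) * multisum d (Suc d) N
      - (if N = 0 then 0 else multisum d (Suc d) (N - 1))" for N
  proof (cases N)
    case (Suc n)
    have "y = x - z" if "x - y = z" for x y z :: "rat fps" using that by (simp add: algebra_simps)
    from this[OF Suc.IH[of n]] show ?thesis unfolding Suc by simp
  qed (simp add: multisum_j_0)
  show ?case
    using multisum_transform_recurrence[OF euler_recip_Suc IH, of j]
    unfolding multisum_Suc_Suc distrib_left sum.distrib .
qed

text \<open>The rows \<open>i\<close> and \<open>2 * l - i\<close> are symmetric, so \<open>\<rho>\<close> folds the rows below the middle one
  onto those above it.\<close>

lemma multisum_row_sum: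
  fixes d i j :: nat
  defines "\<rho> \<equiv> \<lambda>i. if i \<le> Suc d then i else 2 * Suc d - i"
  assumes "i < 2 * Suc d"
  shows "(\<Sum>r=1..<2 * Suc d. q_var ^ (Suc j * nat \<bar>int r - int i\<bar>) * multisum d (\<rho> r) j)
       = (1 - q_var ^ (2 * Suc j)) * multisum d (\<rho> i) (Suc j)"
proof -
  let ?a = "q_var ^ Suc j" and ?u = "\<lambda>i. multisum d (\<rho> i) (Suc j)"
  have sq: "q_var ^ (2 * Suc j) = ?a\<^sup>2"
    by (metis power_mult mult.commute)
  \<comment> \<open>Folding sends 0 and \<open>2 * Suc d\<close> to 0 and their inner neighbours to
    1, so both boundary conditions are \<open>multisum_i_0\<close>.\<close>
  have "?u 0 = ?a * ?u 1" and "?u (2 * Suc d) = ?a * ?u (2 * Suc d - 1)"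
    using multisum_i_0[of d "Suc j"] by (cases d; simp add: \<rho>_def)+
  from tridiagonal_inversion[OF this assms(2)]
  have "(\<Sum>r=1..<2 * Suc d. ?a ^ nat \<bar>int r - int i\<bar> *
      ((1 + ?a\<^sup>2) * ?u r - ?a * (?u (r - 1) + ?u (r + 1)))) = (1 - ?a\<^sup>2) * ?u i" .
  moreover have "(1 + ?a\<^sup>2) * ?u r - ?a * (?u (r - 1) + ?u (r + 1)) = multisum d (\<rho> r) j"
    if r: "r \<in> {1..<2 * Suc d}" for r
  proof -
    consider "r < Suc d" | "r = Suc d" | "r > Suc d" by linarith
    then show ?thesis
    proof cases
      case 1
      then have "\<rho> r = r" "\<rho> (r - 1) = r - 1" "\<rho> (r + 1) = r + 1"
        by (auto simp: \<rho>_def)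
      then show ?thesis
        using multisum_recurrence[of r d j] 1 r unfolding sq by (simp only: atLeastLessThan_iff less_Suc_eq_le)
    next
      case 2
      then have "\<rho> r = Suc d" "\<rho> (r - 1) = d" "\<rho> (r + 1) = d"
        by (auto simp: \<rho>_def)
      then show ?thesis
        using multisum_recurrence_reflected[of j d] unfolding sq by (simp only:)
    next
      case 3
      define s where "s = 2 * Suc d - r"
      have s: "1 \<le> s" "s \<le> d"
        using 3 r by (auto simp: s_def)
      have "\<rho> r = s" "\<rho> (r - 1) = s + 1" "\<rho> (r + 1) = s - 1"
        using 3 r by (auto simp: \<rho>_def s_def)
      then show ?thesis
        using multisum_recurrence[of s d j] s unfolding sq by (simp only: add.commute)
    qed
  qed
  then have "(\<Sum>r=1..<2 * Suc d. ?a ^ nat \<bar>int r - int i\<bar> *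
      ((1 + ?a\<^sup>2) * ?u r - ?a * (?u (r - 1) + ?u (r + 1))))
      = (\<Sum>r=1..<2 * Suc d. q_var ^ (Suc j * nat \<bar>int r - int i\<bar>) * multisum d (\<rho> r) j)"
    by (intro sum.cong refl) (simp only: power_mult)
  ultimately show ?thesis
    unfolding sq by (simp only:)
qed

subsection \<open>Expansion of the right-hand side in powers of z\<close>

text \<open>Splits off the variable \<open>n m\<close>: if \<open>N\<close> is the tail sum from
  \<open>Suc m\<close>, then \<open>n m = j - N\<close> is forced, and the later tail sums do not
  depend on it.\<close>

lemma sum_PiE_compositions_Suc:
  fixes l m j :: nat and W C :: "nat \<Rightarrow> nat \<Rightarrow> 'a::comm_semiring_1"
  defines "comps \<equiv> \<lambda>m j. {n \<in> {m..l} \<rightarrow>\<^sub>E UNIV. N_tail l n m = j}"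
    and "P \<equiv> \<lambda>m n. \<Prod>t=m..l. W t (N_tail l n t) * C t (n t)"
  assumes "m < l"
  shows "sum (P m) (comps m j) = W m j * (\<Sum>N\<le>j. C m (j - N) * sum (P (Suc m)) (comps (Suc m) N))"
proof -
  have ins: "{m..l} = insert m {Suc m..l}" using assms(3) by auto
  have tail: "N_tail l n m = n m + N_tail l n (Suc m)" for n
    unfolding N_tail_def ins by simp
  have tail_upd: "N_tail l (n(m := x)) t = N_tail l n t" if "t > m" for n x t
    unfolding N_tail_def using that by (intro sum.cong) auto
  have fin: "finite (comps m j)" for m j
  proof (rule finite_subset)
    show "comps m j \<subseteq> {m..l} \<rightarrow>\<^sub>E {..j}"
      by (auto simp: comps_def N_tail_def PiE_iff extensional_def intro: member_le_sum)
  qed (auto intro: finite_PiE)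
  have P_m: "P m n = W m (N_tail l n m) * C m (n m) * (\<Prod>t=Suc m..l. W t (N_tail l n t) * C t (n t))" for n
    unfolding P_def ins by simp
  have "sum (P m) (comps m j) =
      (\<Sum>(N, n)\<in>Sigma {..j} (comps (Suc m)). P m (n(m := j - N)))"
  \<comment> \<open>Extensional functions on the shorter index set are \<open>undefined\<close> at
    \<open>m\<close>, hence the reset.\<close>
  proof (rule sum.reindex_bij_witness[where
        i = "\<lambda>(N, n). n(m := j - N)" and j = "\<lambda>n. (N_tail l n (Suc m), n(m := undefined))"])
    fix n assume n: "n \<in> comps m j"
    then show "(case (N_tail l n (Suc m), n(m := undefined)) of (N, n) \<Rightarrow> n(m := j - N)) = n"
      by (auto simp: comps_def tail)
    then show "(case (N_tail l n (Suc m), n(m := undefined)) of (N, n) \<Rightarrow> P m (n(m := j - N))) = P m n"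
      by simp
    show "(N_tail l n (Suc m), n(m := undefined)) \<in> Sigma {..j} (comps (Suc m))"
      using n by (auto simp: comps_def tail tail_upd PiE_iff extensional_def)
  next
    fix b assume b: "b \<in> Sigma {..j} (comps (Suc m))"
    obtain N n where [simp]: "b = (N, n)" by (cases b)
    show "(case b of (N, n) \<Rightarrow> n(m := j - N)) \<in> comps m j"
      using b assms(3) by (auto simp: comps_def tail tail_upd PiE_iff extensional_def)
    have "n(m := undefined) = n"
      using b by (auto simp: comps_def PiE_iff extensional_def)
    then show "(N_tail l (case b of (N, n) \<Rightarrow> n(m := j - N)) (Suc m),
        (case b of (N, n) \<Rightarrow> n(m := j - N))(m := undefined)) = b"
      using b by (auto simp: comps_def tail_upd)
  qed
  also have "\<dots> = (\<Sum>(N, n)\<in>Sigma {..j} (comps (Suc m)). W m j * C m (j - N) * P (Suc m) n)"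
  proof (intro sum.cong refl)
    fix b assume b: "b \<in> Sigma {..j} (comps (Suc m))"
    obtain N n where [simp]: "b = (N, n)" by (cases b)
    from b have "N_tail l (n(m := j - N)) m = j"
      by (auto simp: comps_def tail tail_upd)
    moreover have "(\<Prod>t=Suc m..l. W t (N_tail l (n(m := j - N)) t) * C t ((n(m := j - N)) t))
        = P (Suc m) n"
      unfolding P_def by (intro prod.cong) (auto simp: tail_upd)
    ultimately show "(case b of (N, n) \<Rightarrow> P m (n(m := j - N)))
        = (case b of (N, n) \<Rightarrow> W m j * C m (j - N) * P (Suc m) n)"
      by (simp add: P_m)
  qed
  also have "\<dots> = (\<Sum>N\<le>j. \<Sum>n\<in>comps (Suc m) N. W m j * C m (j - N) * P (Suc m) n)"
    using fin by (subst sum.Sigma) auto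
  finally show ?thesis
    by (simp add: sum_distrib_left mult.assoc)
qed

text \<open>Downward induction on \<open>m\<close>. The linear exponent is present at
  \<open>t\<close> iff \<open>i < t\<close>, that is iff \<open>i - (t - 1) = 0\<close>, which is
  the test that \<open>multisum\<close> makes when \<open>t\<close> is its outermost index.\<close>

lemma sum_PiE_compositions_eq_multisum:
  fixes l i :: nat
  defines "W \<equiv> \<lambda>t N. q_var ^ (N\<^sup>2 + (if i < t then N else 0))"
    and "C \<equiv> \<lambda>t. if t < l then euler_recip else euler_recip2"
  assumes "1 \<le> m" and "m \<le> l"
  shows "(\<Sum>n\<in>{n \<in> {m..l} \<rightarrow>\<^sub>E UNIV. N_tail l n m = j}. \<Prod>t=m..l. W t (N_tail l n t) * C t (n t))
      = q_var ^ j\<^sup>2 * multisum (l - m) (i - (m - 1)) j"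
  using assms(4,3)
proof (induction m arbitrary: j rule: inc_induct)
  case base
  have "{n \<in> {l..l} \<rightarrow>\<^sub>E UNIV. N_tail l n l = j} = {\<lambda>x\<in>{l}. j}"
    by (auto simp: N_tail_def PiE_iff extensional_def)
  then show ?case
    using base by (auto simp: N_tail_def W_def C_def power_add)
next
  case (step m)
  have "(\<Sum>n\<in>{n \<in> {m..l} \<rightarrow>\<^sub>E UNIV. N_tail l n m = j}. \<Prod>t=m..l. W t (N_tail l n t) * C t (n t))
      = W m j * (\<Sum>N\<le>j. C m (j - N) * (q_var ^ N\<^sup>2 * multisum (l - Suc m) (i - m) N))"
    using sum_PiE_compositions_Suc[OF step.hyps(2), of W C j] step.IH by simp
  also have "\<dots> = q_var ^ j\<^sup>2 * multisum (Suc (l - Suc m)) (i - (m - 1)) j"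
    using step by (auto simp: W_def C_def power_add ac_simps)
  finally show ?case
    using step.hyps(2) by (simp add: Suc_diff_Suc)
qed

lemma summand_eq:
  assumes "1 \<le> l" and "i \<le> l"
  shows "summand l i n = z_var ^ N_tail l n 1 * fps_const (\<Prod>t=1..l.
      q_var ^ ((N_tail l n t)\<^sup>2 + (if i < t then N_tail l n t else 0)) *
      (if t < l then euler_recip else euler_recip2) (n t))"
proof -
  let ?N = "N_tail l n"
  let ?D = "(\<Prod>m=1..l-1. qpoch q_var q_var (n m)) * qpoch (q_var\<^sup>2) (q_var\<^sup>2) (n l)"
  have "fps_nth ?D 0 = 1"
    by (simp add: fps_prod_nth_0 qpoch_nth_0)
  then have "x / ?D = x * inverse ?D" for x
    by (intro fps_divide_unit) simp
  moreover have "inverse ?D = (\<Prod>t=1..l-1. euler_recip (n t)) * euler_recip2 (n l)"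
    unfolding euler_recip_def euler_recip2_def
    by (simp add: fps_inverse_mult inverse_prod_fps)
  moreover have "(\<Prod>t=1..l-1. (if t < l then euler_recip else euler_recip2) (n t))
      = (\<Prod>t=1..l-1. euler_recip (n t))"
    by (intro prod.cong) auto
  moreover have "{1..l} = insert l {1..l-1}" using assms by auto
  then have "(\<Prod>t=1..l. (if t < l then euler_recip else euler_recip2) (n t))
      = (\<Prod>t=1..l-1. euler_recip (n t)) * euler_recip2 (n l)"
    using assms calculation(3) by (simp add: mult.commute)
  moreover have "(\<Sum>t=1..l. if i < t then ?N t else 0) = (\<Sum>t=i+1..l. ?N t)"
    by (intro sum.mono_neutral_cong_right) auto
  then have "(\<Prod>t=1..l. q_var ^ ((?N t)\<^sup>2 + (if i < t then ?N t else 0)))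
      = q_var ^ ((\<Sum>m=1..l. (?N m)\<^sup>2) + (\<Sum>m=i+1..l. ?N m))"
    by (simp add: power_sum[symmetric] sum.distrib)
  ultimately show ?thesis
    unfolding summand_def prod.distrib by metis
qed

text \<open>Only the finitely many \<open>n\<close> with \<open>N_tail l n 1 = j\<close> contribute
  to the coefficient of \<open>z ^ j\<close>, so every finite partial sum containing them already
  has the final coefficient.\<close>

lemma summand_has_sum:
  assumes "1 \<le> l" and "i \<le> l"
  shows "(summand l i has_sum Abs_fps (\<lambda>j. q_var ^ j\<^sup>2 * multisum (l - 1) i j))
    ({1..l} \<rightarrow>\<^sub>E (UNIV :: nat set))"
  unfolding has_sum_def
proof (rule tendsto_fpsI)
  fix j :: nat
  let ?A = "{1..l} \<rightarrow>\<^sub>E (UNIV :: nat set)" and ?J = "{n \<in> {1..l} \<rightarrow>\<^sub>E UNIV. N_tail l n 1 = j}"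
  define P where "P n = (\<Prod>t=1..l.
      q_var ^ ((N_tail l n t)\<^sup>2 + (if i < t then N_tail l n t else 0)) *
      (if t < l then euler_recip else euler_recip2) (n t))" for n
  have fin: "finite ?J"
  proof (rule finite_subset)
    show "?J \<subseteq> {1..l} \<rightarrow>\<^sub>E {..j}"
      by (auto simp: N_tail_def PiE_iff extensional_def intro: member_le_sum)
  qed (auto intro: finite_PiE)
  have nth: "fps_nth (summand l i n) j = (if N_tail l n 1 = j then P n else 0)" for n
    unfolding summand_eq[OF assms] P_def by auto
  have "fps_nth (sum (summand l i) X) j = q_var ^ j\<^sup>2 * multisum (l - 1) i j"
    if "finite X" "?J \<subseteq> X" "X \<subseteq> ?A" for X
  proof -
    have "fps_nth (sum (summand l i) X) j = sum P ?J"
      unfolding fps_sum_nth nth using that by (intro sum.mono_neutral_cong_right) auto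
    also have "\<dots> = q_var ^ j\<^sup>2 * multisum (l - 1) i j"
      unfolding P_def using sum_PiE_compositions_eq_multisum[of 1 l i j] assms by simp
    finally show ?thesis .
  qed
  with fin show "\<forall>\<^sub>F X in finite_subsets_at_top ?A. fps_nth (sum (summand l i) X) j
      = fps_nth (Abs_fps (\<lambda>j. q_var ^ j\<^sup>2 * multisum (l - 1) i j)) j"
    unfolding eventually_finite_subsets_at_top by (intro exI[of _ ?J]) auto
qed

subsection \<open>Counting separated sets of parts\<close>

text \<open>Rows \<open>1, \<dots>, m - 1\<close>. By parity \<open>\<bar>r - i\<bar> < s\<close> is the same as \<open>\<bar>r - i\<bar> < s + 1\<close>, so the first
  condition says that \<open>(r, s)\<close> is also separated from a virtual part \<open>- 1\<close> in row \<open>i\<close>.\<close>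

definition row_chains :: "nat \<Rightarrow> nat \<Rightarrow> (nat \<times> nat) set set" where
  "row_chains m i = {A. finite A \<and>
     (\<forall>r s. (r, s) \<in> A \<longrightarrow> r \<in> {1..<m} \<and> \<bar>int r - int i\<bar> < int s \<and> odd (r + i + s)) \<and>
     (\<forall>r s r' s'. (r, s) \<in> A \<longrightarrow> (r', s') \<in> A \<longrightarrow> (r, s) \<noteq> (r', s') \<longrightarrow>
       \<bar>int r - int r'\<bar> < \<bar>int s - int s'\<bar>)}"

definition chains_of :: "nat \<Rightarrow> nat \<Rightarrow> nat \<Rightarrow> nat \<Rightarrow> (nat \<times> nat) set set" where
  "chains_of m i j n = {A \<in> row_chains m i. card A = j \<and> sum snd A = n}"

definition chain_series :: "nat \<Rightarrow> nat \<Rightarrow> nat \<Rightarrow> rat fps" where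
  "chain_series m i j = Abs_fps (\<lambda>n. of_nat (card (chains_of m i j n)))"

lemma finite_chains_of: "finite (chains_of m i j n)"
proof (rule finite_subset)
  show "chains_of m i j n \<subseteq> Pow ({1..<m} \<times> {..n})"
  proof (intro subsetI PowI)
    fix A x assume A: "A \<in> chains_of m i j n" "x \<in> A"
    obtain r s where x: "x = (r, s)" by (cases x)
    have "s \<le> sum snd A"
      using member_le_sum[of x A snd] A by (auto simp: x chains_of_def row_chains_def)
    moreover have "r \<in> {1..<m}"
      using A unfolding x chains_of_def row_chains_def by blast
    ultimately show "x \<in> {1..<m} \<times> {..n}"
      using A by (auto simp: x chains_of_def)
  qed
qed auto

section \<open>Removing the smallest part\<close>

definition shift_parts :: "nat \<Rightarrow> nat \<times> nat \<Rightarrow> nat \<times> nat" where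
  "shift_parts c = map_prod id (\<lambda>s. s + c)"

lemma shift_parts_simp [simp]: "shift_parts c (r, s) = (r, s + c)"
  by (simp add: shift_parts_def)

lemma inj_shift_parts: "inj (shift_parts c)"
  by (auto simp: inj_def shift_parts_def)

text \<open>The shift by \<open>s + 1\<close> moves the smallest part \<open>s\<close> to \<open>- 1\<close>, where it plays the role of the
  virtual part for the remaining ones.\<close>

definition extend_chain :: "nat \<times> nat \<Rightarrow> (nat \<times> nat) set \<Rightarrow> (nat \<times> nat) set" where
  "extend_chain x B = insert x (shift_parts (Suc (snd x)) ` B)"

text \<open>\<open>x\<close> is recovered as the unique element of smallest size; removing it and
  undoing the shift gives \<open>B\<close>.\<close>

lemma extend_chain_inject:
  assumes "extend_chain x B = extend_chain x' B'"
  shows "x = x' \<and> B = B'"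
proof -
  have "snd x \<le> snd y" "snd y = snd x \<Longrightarrow> y = x" if "y \<in> extend_chain x B" for x y B
    using that by (auto simp: extend_chain_def)
  moreover have "x \<in> extend_chain x B" for x B
    by (simp add: extend_chain_def)
  ultimately have x: "x = x'"
    using assms by (metis le_antisym)
  have "shift_parts (Suc (snd x)) ` B = extend_chain x B - {x}" for B
    by (cases x) (auto simp: extend_chain_def)
  then have "shift_parts (Suc (snd x)) ` B = shift_parts (Suc (snd x)) ` B'"
    using assms x by metis
  then show ?thesis
    using x inj_shift_parts by (simp add: inj_image_eq_iff)
qed

text \<open>Differences within the shifted \<open>B\<close> are unchanged, and a part of size
  \<open>t\<close> in \<open>B\<close> ends at distance \<open>t + 1\<close> from \<open>s\<close>.
  Separation from row \<open>i\<close> is the triangle inequality through row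
  \<open>r\<close>.\<close>

lemma extend_chain_in_chains:
  assumes "r \<in> {1..<m}" "\<bar>int r - int i\<bar> < int s" "odd (r + i + s)" "B \<in> row_chains m r"
  shows "extend_chain (r, s) B \<in> row_chains m i"
proof -
  have "finite B"
    using assms(4) by (simp add: row_chains_def)
  have first: "r' \<in> {1..<m} \<and> \<bar>int r' - int r\<bar> < int t \<and> odd (r' + r + t)" if "(r', t) \<in> B" for r' t
    using assms(4) that unfolding row_chains_def by blast
  have sep: "\<bar>int r' - int r''\<bar> < \<bar>int t - int t'\<bar>"
    if "(r', t) \<in> B" "(r'', t') \<in> B" "(r', t) \<noteq> (r'', t')" for r' t r'' t'
    using assms(4) that unfolding row_chains_def by blast
  have mem: "(r', s') \<in> extend_chain (r, s) B \<longleftrightarrow>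
      (r', s') = (r, s) \<or> (\<exists>t. s' = t + Suc s \<and> (r', t) \<in> B)" for r' s'
    by (force simp: extend_chain_def)
  show ?thesis
    unfolding row_chains_def
  proof (intro CollectI conjI allI impI)
    show "finite (extend_chain (r, s) B)"
      using \<open>finite B\<close> by (simp add: extend_chain_def)
  next
    fix r' s' assume "(r', s') \<in> extend_chain (r, s) B"
    then have "r' \<in> {1..<m} \<and> \<bar>int r' - int i\<bar> < int s' \<and> odd (r' + i + s')"
      unfolding mem
    proof (elim disjE exE conjE)
      fix t assume "s' = t + Suc s" "(r', t) \<in> B"
      then show ?thesis using first[of r' t] assms(2,3) by (auto; presburger)
    qed (use assms in auto)
    then show "r' \<in> {1..<m}" "\<bar>int r' - int i\<bar> < int s'" "odd (r' + i + s')" by auto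
  next
    fix r1 s1 r2 s2
    assume "(r1, s1) \<in> extend_chain (r, s) B" "(r2, s2) \<in> extend_chain (r, s) B"
      "(r1, s1) \<noteq> (r2, s2)"
    then show "\<bar>int r1 - int r2\<bar> < \<bar>int s1 - int s2\<bar>"
      unfolding mem using first sep by (fastforce simp: abs_minus_commute)
  qed
qed

text \<open>Take the part of smallest size as \<open>(r, s)\<close>; all others exceed
  \<open>s\<close> by more than their row distance, so they can be shifted down by
  \<open>Suc s\<close>.\<close>

lemma chain_eq_extend_chain:
  assumes "A \<in> row_chains m i" and "A \<noteq> {}"
  obtains r s B where "A = extend_chain (r, s) B"
    and "r \<in> {1..<m}" "\<bar>int r - int i\<bar> < int s" "odd (r + i + s)" "B \<in> row_chains m r"
proof -
  have fin: "finite A"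
    using assms(1) by (simp add: row_chains_def)
  have mem: "r \<in> {1..<m} \<and> \<bar>int r - int i\<bar> < int t \<and> odd (r + i + t)" if "(r, t) \<in> A" for r t
    using assms(1) that unfolding row_chains_def by blast
  have sep: "\<bar>int r - int r'\<bar> < \<bar>int t - int t'\<bar>"
    if "(r, t) \<in> A" "(r', t') \<in> A" "(r, t) \<noteq> (r', t')" for r t r' t'
    using assms(1) that unfolding row_chains_def by blast
  obtain r s where rs: "(r, s) \<in> A" and min: "\<And>r' t. (r', t) \<in> A \<Longrightarrow> s \<le> t"
    using ex_min_if_finite[of "snd ` A"] fin assms(2)
    by (metis (no_types, lifting) image_iff image_is_empty finite_imageI not_le prod.collapse snd_conv)
  define B where "B = shift_parts (Suc s) -` A"
  have B: "(r', t) \<in> B \<longleftrightarrow> (r', t + Suc s) \<in> A" for r' t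
    by (simp add: B_def)
  have above: "(r', t) = (r, s) \<or> \<bar>int r' - int r\<bar> < int t - int s" if "(r', t) \<in> A" for r' t
    using sep[OF that rs] min[OF that] by auto
  show ?thesis
  proof
    show "A = extend_chain (r, s) B"
    proof (intro set_eqI iffI)
      fix x assume "x \<in> A"
      moreover obtain r' t where x: "x = (r', t)" by (cases x)
      ultimately have "x = (r, s) \<or> (r', t - Suc s + Suc s) \<in> A \<and> t = t - Suc s + Suc s"
        using above[of r' t] by auto
      then show "x \<in> extend_chain (r, s) B"
        unfolding extend_chain_def x B[symmetric] by force
    qed (use rs in \<open>auto simp: extend_chain_def B_def\<close>)
    show "r \<in> {1..<m}" "\<bar>int r - int i\<bar> < int s" "odd (r + i + s)"
      using mem[OF rs] by auto
    show "B \<in> row_chains m r"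
      unfolding row_chains_def mem_Collect_eq B
    proof (intro conjI allI impI)
      show "finite B"
        unfolding B_def using fin inj_shift_parts by (rule finite_vimageI)
    next
      fix r' t assume A: "(r', t + Suc s) \<in> A"
      have "\<bar>int r' - int r\<bar> < int t + 1" using above[OF A] by auto
      moreover have odd: "odd (r' + r + t)"
        using mem[OF A] mem[OF rs] by auto
      \<comment> \<open>Separation from the removed part only bounds the row distance by
        \<open>t + 1\<close>; parity excludes equality with \<open>t\<close>.\<close>
      moreover have "\<bar>int r' - int r\<bar> \<noteq> int t"
        using odd by presburger
      ultimately show "r' \<in> {1..<m}" "\<bar>int r' - int r\<bar> < int t" "odd (r' + r + t)"
        using mem[OF A] by auto
    next
      fix r1 s1 r2 s2
      assume "(r1, s1 + Suc s) \<in> A" "(r2, s2 + Suc s) \<in> A" "(r1, s1) \<noteq> (r2, s2)"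
      then show "\<bar>int r1 - int r2\<bar> < \<bar>int s1 - int s2\<bar>"
        using sep[of r1 "s1 + Suc s" r2 "s2 + Suc s"] by simp
    qed
  qed
qed

lemma sum_snd_extend_chain:
  assumes "finite B"
  shows "sum snd (extend_chain (r, s) B) = s + card B * Suc s + sum snd B"
proof -
  have "sum snd (extend_chain (r, s) B) = s + sum snd (shift_parts (Suc s) ` B)"
    unfolding extend_chain_def using assms by (subst sum.insert) auto
  also have "sum snd (shift_parts (Suc s) ` B) = (\<Sum>x\<in>B. snd x + Suc s)"
    by (subst sum.reindex[OF inj_on_subset[OF inj_shift_parts]]) (auto simp: shift_parts_def)
  finally show ?thesis
    by (simp only: sum.distrib sum_constant add.commute add.left_commute of_nat_id)
qed

lemma card_extend_chain: "finite B \<Longrightarrow> card (extend_chain (r, s) B) = Suc (card B)"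
  unfolding extend_chain_def
  by (subst card_insert_disjoint) (auto simp: card_image[OF inj_on_subset[OF inj_shift_parts]])

text \<open>The possible sizes of the smallest part if it lies in row \<open>r\<close>.\<close>

definition first_parts :: "nat \<Rightarrow> nat \<Rightarrow> nat set" where
  "first_parts i r = {s. \<bar>int r - int i\<bar> < int s \<and> odd (r + i + s)}"

text \<open>The smallest part contributes \<open>s\<close>, and the shift adds \<open>s + 1\<close>
  to each of the \<open>j\<close> others: \<open>Suc j * s + j\<close> in all.\<close>

lemma card_chains_of_Suc:
  "card (chains_of m i (Suc j) n) =
    (\<Sum>r=1..<m. \<Sum>s | s \<in> first_parts i r \<and> Suc j * s + j \<le> n.
      card (chains_of m r j (n - (Suc j * s + j))))"
proof -
  define S where "S r = {s. s \<in> first_parts i r \<and> Suc j * s + j \<le> n}" for r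
  define D where "D = (SIGMA r:{1..<m}. SIGMA s:S r. chains_of m r j (n - (Suc j * s + j)))"
  have fin: "finite (S r)" for r
  proof (rule finite_subset)
    show "S r \<subseteq> {..n}" by (auto simp: S_def)
  qed auto
  have "bij_betw (\<lambda>(r, s, B). extend_chain (r, s) B) D (chains_of m i (Suc j) n)"
    unfolding bij_betw_def
  proof
    show "inj_on (\<lambda>(r, s, B). extend_chain (r, s) B) D"
      by (auto simp: inj_on_def dest: extend_chain_inject)
    show "(\<lambda>(r, s, B). extend_chain (r, s) B) ` D = chains_of m i (Suc j) n"
    proof (intro set_eqI iffI)
      fix A assume "A \<in> (\<lambda>(r, s, B). extend_chain (r, s) B) ` D"
      then obtain r s B where A: "A = extend_chain (r, s) B"
        and r: "r \<in> {1..<m}" and s: "s \<in> first_parts i r" "Suc j * s + j \<le> n"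
        and B: "B \<in> chains_of m r j (n - (Suc j * s + j))"
        by (auto simp: D_def S_def)
      have "finite B" "card B = j" "B \<in> row_chains m r" "sum snd B = n - (Suc j * s + j)"
        using B by (auto simp: chains_of_def row_chains_def)
      then show "A \<in> chains_of m i (Suc j) n"
        using r s extend_chain_in_chains[of r m i s B]
        unfolding A by (auto simp: chains_of_def first_parts_def card_extend_chain sum_snd_extend_chain)
    next
      fix A assume A: "A \<in> chains_of m i (Suc j) n"
      then have "A \<in> row_chains m i" "A \<noteq> {}" by (auto simp: chains_of_def)
      then obtain r s B where A': "A = extend_chain (r, s) B"
        and *: "r \<in> {1..<m}" "\<bar>int r - int i\<bar> < int s" "odd (r + i + s)" "B \<in> row_chains m r"
        by (rule chain_eq_extend_chain)
      have "finite B" using *(4) by (simp add: row_chains_def)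
      then have "(r, s, B) \<in> D"
        using A * by (auto simp: D_def S_def A' chains_of_def first_parts_def
            card_extend_chain sum_snd_extend_chain)
      then show "A \<in> (\<lambda>(r, s, B). extend_chain (r, s) B) ` D"
        unfolding A' by force
    qed
  qed
  then have "card (chains_of m i (Suc j) n) = card D"
    by (simp add: bij_betw_same_card)
  also have "\<dots> = (\<Sum>r=1..<m. \<Sum>s\<in>S r. card (chains_of m r j (n - (Suc j * s + j))))"
    unfolding D_def using fin finite_chains_of by (simp add: card_SigmaI finite_SigmaI)
  finally show ?thesis unfolding S_def .
qed

section \<open>Generating functions of separated sets\<close>

text \<open>The geometric series \<open>fps_X ^ c / (1 - fps_X ^ p)\<close>, cleared of its
  denominator.\<close>

lemma fps_arith_progression:
  fixes c p :: nat
  assumes "p > 0"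
  shows "Abs_fps (\<lambda>n. if \<exists>t. n = c + p * t then 1 else 0) * (1 - fps_X ^ p) = (fps_X ^ c :: 'a::comm_ring_1 fps)"
proof (rule fps_ext)
  fix n
  have "t = 0" if "n < p" "n = c + p * t" for t
    using that by (cases t) auto
  then have "n < p \<Longrightarrow> (\<exists>t. n = c + p * t) \<longleftrightarrow> n = c"
    by (metis add_0_right mult_0_right)
  moreover have "(\<exists>t. n = c + p * t) \<longleftrightarrow> n = c \<or> (\<exists>t. n - p = c + p * t)" if "p \<le> n"
  proof
    assume "\<exists>t. n = c + p * t"
    then obtain t where t: "n = c + p * t" by blast
    then show "n = c \<or> (\<exists>t. n - p = c + p * t)"
      by (cases t) auto
  next
    assume "n = c \<or> (\<exists>t. n - p = c + p * t)"
    then show "\<exists>t. n = c + p * t"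
    proof (elim disjE exE)
      fix t assume "n - p = c + p * t"
      then have "n = c + p * Suc t" using that by simp
      then show ?thesis by blast
    qed (auto intro: exI[of _ 0])
  qed
  moreover have "n - p \<noteq> c + p * t" if "n = c" "p \<le> n" for t
    using that assms by auto
  ultimately show "fps_nth (Abs_fps (\<lambda>n. if \<exists>t. n = c + p * t then 1 else 0) * (1 - fps_X ^ p)) n
      = fps_nth (fps_X ^ c :: 'a fps) n"
    by (auto simp: right_diff_distrib fps_X_power_mult_right_nth fps_X_power_nth)
qed

lemma first_parts_eq:
  "first_parts i r = range (\<lambda>t. nat \<bar>int r - int i\<bar> + 1 + 2 * t)"
proof (intro set_eqI iffI)
  fix s assume "s \<in> first_parts i r"
  then have "nat \<bar>int r - int i\<bar> < s" and odd: "odd (s - nat \<bar>int r - int i\<bar>)"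
    by (auto simp: first_parts_def)
  from odd obtain t where "s - nat \<bar>int r - int i\<bar> = 2 * t + 1"
    by (rule oddE)
  then show "s \<in> range (\<lambda>t. nat \<bar>int r - int i\<bar> + 1 + 2 * t)"
    using \<open>nat \<bar>int r - int i\<bar> < s\<close> by (intro image_eqI[of _ _ t]) auto
qed (auto simp: first_parts_def)

lemma chain_series_0: "chain_series m i 0 = 1"
proof -
  have "chains_of m i 0 n = (if n = 0 then {{}} else {})" for n
    by (auto simp: chains_of_def row_chains_def)
  then show ?thesis
    by (auto simp: chain_series_def fps_eq_iff)
qed

text \<open>\<open>G r\<close> generates the weight due to a smallest part in row \<open>r\<close>.
  Sizes there have step 2, so its exponents have step \<open>2 * Suc j\<close>.\<close>

lemma chain_series_Suc:
  "chain_series m i (Suc j) * (1 - q_var ^ (2 * Suc j)) =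
    (\<Sum>r=1..<m. q_var ^ (Suc j * (nat \<bar>int r - int i\<bar> + 1) + j) * chain_series m r j)"
proof -
  let ?e = "\<lambda>s. Suc j * s + j"
  define G where "G r = Abs_fps (\<lambda>n. if n \<in> ?e ` first_parts i r then 1 else 0 :: rat)" for r
  have nth: "fps_nth (G r * chain_series m r j) n
      = (\<Sum>s | s \<in> first_parts i r \<and> ?e s \<le> n. of_nat (card (chains_of m r j (n - ?e s))))" for r n
  proof -
    have "fps_nth (G r * chain_series m r j) n = (\<Sum>k=0..n. fps_nth (G r) k * fps_nth (chain_series m r j) (n - k))"
      by (rule fps_mult_nth)
    also have "\<dots> = (\<Sum>k\<in>?e ` {s. s \<in> first_parts i r \<and> ?e s \<le> n}. fps_nth (chain_series m r j) (n - k))"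
      by (rule sum.mono_neutral_cong_right) (auto simp: G_def)
    also have "\<dots> = (\<Sum>s | s \<in> first_parts i r \<and> ?e s \<le> n. fps_nth (chain_series m r j) (n - ?e s))"
      by (subst sum.reindex) (auto simp: inj_on_def simp del: mult_Suc)
    finally show ?thesis by (simp add: chain_series_def)
  qed
  have "chain_series m i (Suc j) = (\<Sum>r=1..<m. G r * chain_series m r j)"
    by (rule fps_ext) (simp add: fps_sum_nth nth, simp add: chain_series_def card_chains_of_Suc)
  moreover have "G r * (1 - q_var ^ (2 * Suc j)) = q_var ^ (Suc j * (nat \<bar>int r - int i\<bar> + 1) + j)" for r
  proof -
    let ?c = "Suc j * (nat \<bar>int r - int i\<bar> + 1) + j"
    have "?e (nat \<bar>int r - int i\<bar> + 1 + 2 * t) = ?c + 2 * Suc j * t" for t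
      by (simp add: algebra_simps)
    then have "n \<in> ?e ` first_parts i r \<longleftrightarrow> (\<exists>t. n = ?c + 2 * Suc j * t)" for n
      unfolding first_parts_eq image_image by (metis (no_types, lifting) rangeE rangeI)
    then have "G r = Abs_fps (\<lambda>n. if \<exists>t. n = ?c + 2 * Suc j * t then 1 else 0)"
      by (simp only: G_def)
    then show ?thesis
      using fps_arith_progression[of "2 * Suc j" ?c] by simp
  qed
  moreover have "(\<Sum>r=1..<m. G r * chain_series m r j) * (1 - q_var ^ (2 * Suc j))
      = (\<Sum>r=1..<m. G r * (1 - q_var ^ (2 * Suc j)) * chain_series m r j)"
    unfolding sum_distrib_right by (intro sum.cong refl) (simp only: ac_simps)
  ultimately show ?thesis by (simp only:)
qed

text \<open>Induction on \<open>j\<close>: once the square is split off,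
  \<open>chain_series_Suc\<close> and \<open>multisum_row_sum\<close> are the same recursion, and
  the common factor \<open>1 - q_var ^ (2 * Suc j)\<close> cancels.\<close>

lemma chain_series_eq_multisum:
  fixes d i j :: nat
  defines "\<rho> \<equiv> \<lambda>i. if i \<le> Suc d then i else 2 * Suc d - i"
  assumes "i < 2 * Suc d"
  shows "chain_series (2 * Suc d) i j = q_var ^ j\<^sup>2 * multisum d (\<rho> i) j"
  using assms(2)
proof (induction j arbitrary: i)
  case 0
  then show ?case by (simp add: chain_series_0 multisum_j_0)
next
  case (Suc j)
  have "chain_series (2 * Suc d) i (Suc j) * (1 - q_var ^ (2 * Suc j)) =
      (\<Sum>r=1..<2 * Suc d. q_var ^ (Suc j * (nat \<bar>int r - int i\<bar> + 1) + j) * (q_var ^ j\<^sup>2 * multisum d (\<rho> r) j))"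
    unfolding chain_series_Suc using Suc.IH
    by (intro sum.cong refl arg_cong2[where f = "(*)"]) (simp only: atLeastLessThan_iff)
  also have "\<dots> = (\<Sum>r=1..<2 * Suc d. q_var ^ (Suc j)\<^sup>2 * (q_var ^ (Suc j * nat \<bar>int r - int i\<bar>) * multisum d (\<rho> r) j))"
  proof (intro sum.cong refl)
    fix r
    have "Suc j * (nat \<bar>int r - int i\<bar> + 1) + j + j\<^sup>2 = (Suc j)\<^sup>2 + Suc j * nat \<bar>int r - int i\<bar>"
      by (simp add: power2_eq_square algebra_simps)
    then have "q_var ^ (Suc j * (nat \<bar>int r - int i\<bar> + 1) + j) * q_var ^ j\<^sup>2
        = q_var ^ (Suc j)\<^sup>2 * q_var ^ (Suc j * nat \<bar>int r - int i\<bar>)"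
      by (simp only: power_add[symmetric])
    then show "q_var ^ (Suc j * (nat \<bar>int r - int i\<bar> + 1) + j) * (q_var ^ j\<^sup>2 * multisum d (\<rho> r) j)
        = q_var ^ (Suc j)\<^sup>2 * (q_var ^ (Suc j * nat \<bar>int r - int i\<bar>) * multisum d (\<rho> r) j)"
      by (simp only: mult.assoc[symmetric])
  qed
  also have "\<dots> = q_var ^ (Suc j)\<^sup>2 * multisum d (\<rho> i) (Suc j) * (1 - q_var ^ (2 * Suc j))"
    unfolding sum_distrib_left[symmetric] \<rho>_def multisum_row_sum[OF Suc.prems]
    by (simp only: ac_simps)
  finally have eq: "chain_series (2 * Suc d) i (Suc j) * (1 - q_var ^ (2 * Suc j))
      = q_var ^ (Suc j)\<^sup>2 * multisum d (\<rho> i) (Suc j) * (1 - q_var ^ (2 * Suc j))" .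
  have "fps_nth (1 - q_var ^ (2 * Suc j)) 0 = 1"
    by (simp add: fps_power_zeroth)
  then have "1 - q_var ^ (2 * Suc j) \<noteq> 0" by (metis fps_zero_nth zero_neq_one)
  with eq show ?case by (metis mult_right_cancel)
qed

subsection \<open>Admissible partitions as separated sets\<close>

lemma downward_path_abs_diff_le:
  assumes "downward_path A l p" and "a \<le> b" and "1 \<le> a" and "b \<le> 2 * l - 1"
  shows "\<bar>p b - p a\<bar> \<le> int b - int a"
  using assms(2,4)
proof (induction b rule: dec_induct)
  case (step n)
  have "\<bar>p (n + 1) - p n\<bar> = 1"
    using assms(1,3) step by (auto simp: downward_path_def)
  then show ?case using step by auto
qed simp

text \<open>The witness is the upper envelope of the lowest path and of the two steepest tents with their
  tops at the prescribed entries; all three have steps of size 1 and the same parity.\<close>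

lemma exists_downward_path_through:
  assumes "s \<in> positions A a" and "t \<in> positions A b"
    and "\<bar>s - t\<bar> \<le> \<bar>int a - int b\<bar>"
  obtains p where "downward_path A l p" and "p a = s" and "p b = t"
proof
  define low where "low r = (if odd_row A r then - 1 else 0 :: int)" for r
  define p where "p r = max (low r) (max (s - \<bar>int r - int a\<bar>) (t - \<bar>int r - int b\<bar>))" for r
  have row: "odd_row A r \<longleftrightarrow> odd r = odd_row A 1" for r
    by (cases A) auto
  have pos: "x \<in> positions A r \<longleftrightarrow> low r \<le> x \<and> even (x - low r)" for x r
    by (auto simp: positions_def low_def)
  have low: "odd (low r) \<longleftrightarrow> odd r = odd_row A 1" "low r \<in> {-1, 0}" for r
    using row[of r] by (auto simp: low_def)
  have s: "low a \<le> s" "even s = even (low a)" and t: "low b \<le> t" "even t = even (low b)"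
    using assms(1,2) pos by auto
  have par: "even (s - \<bar>int r - int a\<bar>) \<longleftrightarrow> even (low r)" "even (t - \<bar>int r - int b\<bar>) \<longleftrightarrow> even (low r)" for r
    using s(2) t(2) low(1)[of a] low(1)[of b] low(1)[of r] by (cases "odd_row A 1"; auto; presburger)+
  have "p r \<in> positions A r" for r
    using par[of r] unfolding pos p_def by (auto simp: max_def)
  moreover have "\<bar>p (r + 1) - p r\<bar> = 1" for r
  proof -
    have "\<bar>low (r + 1) - low r\<bar> = 1" 
      using row[of r] row[of "r + 1"] by (auto simp: low_def)
    moreover have "\<bar>(x - \<bar>int (r + 1) - int c\<bar>) - (x - \<bar>int r - int c\<bar>)\<bar> = 1" for x c
      by auto
    \<comment> \<open>If \<open>x\<close> and \<open>y\<close> differ, parity makes them differ by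
      at least 2, so one step cannot reverse their order.\<close>
    moreover have "\<bar>max x' y' - max x y\<bar> = 1"
      if "\<bar>x' - x\<bar> = 1" "\<bar>y' - y\<bar> = 1" "even x = even y" for x x' y y' :: int
      using that by presburger
    moreover have "even (max x y) = even x" if "even x = even y" for x y :: int
      using that by (simp add: max_def)
    ultimately show ?thesis
      unfolding p_def using par[of r] by metis
  qed
  ultimately show "downward_path A l p"
    by (simp add: downward_path_def)
  show "p a = s" "p b = t"
    using s(1) t(1) assms(3) by (auto simp: p_def max_def)
qed

text \<open>The parity of \<open>i\<close> selects the array in which row \<open>i\<close> receives
  \<open>k i\<close>; the exception is \<open>k 0\<close>, which is placed in row 1.\<close>

lemma extra_entry_unit:
  assumes "i \<le> l" and "1 \<le> r"
  shows "extra_entry (array_of i) l (\<lambda>m. if m = i then 1 else 0) r = (if r = max 1 i then 1 else 0)"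
  using assms by (cases "i = 0") (auto simp: array_of_def max_def)

lemma part_parity:
  "(r, s) \<in> parts (array_of i) l \<longleftrightarrow> r \<in> {1..<2 * l} \<and> 1 \<le> s \<and> odd (r + i + s)"
  by (auto simp: parts_def array_of_def)

lemma sum_le_1_if_single_support:
  fixes f :: "'a \<Rightarrow> nat"
  assumes "finite R" and "\<And>a. a \<in> R \<Longrightarrow> f a \<le> 1"
    and "\<And>a b. a \<in> R \<Longrightarrow> b \<in> R \<Longrightarrow> 0 < f a \<Longrightarrow> 0 < f b \<Longrightarrow> a = b"
  shows "sum f R \<le> 1"
proof (cases "\<exists>a\<in>R. 0 < f a")
  case True
  then obtain a where a: "a \<in> R" "0 < f a" by blast
  have "sum f (R - {a}) = 0"
    using a assms(3) by (intro sum.neutral) auto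
  then show ?thesis
    using sum.remove[OF assms(1) a(1), of f] assms(2)[OF a(1)] by simp
qed simp

text \<open>The extra entry 1 sits in row \<open>max 1 i\<close>, at position 0 if \<open>i = 0\<close> and at position
  \<open>- 1\<close> otherwise. In both cases it forbids the same parts as a part \<open>- 1\<close> in row \<open>i\<close> would do.\<close>

lemma admissible_unit_iff:
  assumes "1 \<le> l" and "i \<le> l" and \<pi>: "set_mset \<pi> \<subseteq> parts (array_of i) l"
  shows "admissible (array_of i) l (\<lambda>m. if m = i then 1 else 0) \<pi> \<longleftrightarrow>
    (\<forall>x. count \<pi> x \<le> 1) \<and> set_mset \<pi> \<in> row_chains (2 * l) i"
proof -
  let ?A = "array_of i" and ?k = "\<lambda>m. if m = i then 1 else 0 :: nat"
  let ?R = "{1..2 * l - 1}"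
  define r0 where "r0 = max 1 i"
  define s0 :: int where "s0 = (if i = 0 then 0 else - 1)"
  define E where "E = entry ?A l ?k \<pi>"
  have k: "(\<Sum>m=0..l. ?k m) = 1"
    using assms(2) by simp
  have E: "E r s = (if 1 \<le> s then count \<pi> (r, nat s) else if r = r0 then 1 else 0)" if "1 \<le> r" for r s
    unfolding E_def entry_def r0_def using extra_entry_unit[OF assms(2) that] by simp
  have r0: "r0 \<in> ?R" using assms by (auto simp: r0_def)
  have s0: "s \<in> positions ?A r0 \<and> s \<le> 0 \<longleftrightarrow> s = s0" for s
  proof -
    have "- 1 \<le> s \<and> odd s \<and> s \<le> 0 \<longleftrightarrow> s = - 1" by presburger
    then show ?thesis
      by (cases "i = 0") (auto simp: positions_def array_of_def r0_def s0_def max_def)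
  qed
  have part: "r \<in> ?R" "1 \<le> s" "odd (r + i + s)" "int s \<in> positions ?A r" if "(r, s) \<in># \<pi>" for r s
    using \<pi> that part_parity[of r s i l] by (auto simp: positions_def array_of_def)
  \<comment> \<open>For \<open>i = 0\<close> the extra entry is in row 1 at position 0, and
    \<open>r - 1 < s\<close> agrees with \<open>r < s\<close> because \<open>r + s\<close> is odd.
    For \<open>i > 0\<close> parity excludes
    \<open>\<bar>int r - int i\<bar> = int s\<close>.\<close>
  have far: "\<bar>int r - int r0\<bar> < int s - s0 \<longleftrightarrow> \<bar>int r - int i\<bar> < int s"
    if "1 \<le> r" "1 \<le> s" "odd (r + i + s)" for r s
    using that by (cases "i = 0"; auto simp: r0_def s0_def max_def; presburger)
  show ?thesis
  proof
    assume adm: "admissible ?A l ?k \<pi>"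
    have path_sum: "(\<Sum>r\<in>X. E r (p r)) \<le> 1" if "downward_path ?A l p" "X \<subseteq> ?R" for p X
    proof -
      have "(\<Sum>r\<in>X. E r (p r)) \<le> (\<Sum>r\<in>?R. E r (p r))"
        using that(2) by (intro sum_mono2) auto
      also have "\<dots> \<le> 1"
        using adm that(1) unfolding admissible_def k E_def by blast
      finally show ?thesis .
    qed
    have one: "E a s \<le> 1" if as: "a \<in> ?R" "s \<in> positions ?A a" for a s
    proof -
      obtain p where "downward_path ?A l p" "p a = s"
        by (rule exists_downward_path_through[of s ?A a s a]) (use as in auto)
      then show ?thesis using path_sum[of p "{a}"] as by simp
    qed
    \<comment> \<open>A common path through both entries exists, and this yields all the separation
      conditions below.\<close>
    have two: "E a s + E b t \<le> 1"
      if ab: "a \<in> ?R" "b \<in> ?R" "a \<noteq> b" "s \<in> positions ?A a" "t \<in> positions ?A b"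
        "\<bar>s - t\<bar> \<le> \<bar>int a - int b\<bar>" for a b s t
    proof -
      obtain p where "downward_path ?A l p" "p a = s" "p b = t"
        by (rule exists_downward_path_through[of s ?A a t b]) (use ab in auto)
      then show ?thesis using path_sum[of p "{a, b}"] ab by simp
    qed
    have "count \<pi> (r, s) \<le> 1" for r s
    proof (cases "(r, s) \<in># \<pi>")
      case True
      then show ?thesis using one[of r "int s"] part[OF True] by (simp add: E)
    qed (simp add: not_in_iff)
    moreover have "set_mset \<pi> \<in> row_chains (2 * l) i"
      unfolding row_chains_def
    proof (intro CollectI conjI allI impI)
      fix r s assume rs: "(r, s) \<in># \<pi>"
      note p = part[OF rs]
      show "r \<in> {1..<2 * l}" "odd (r + i + s)" using p by auto
      have "\<not> \<bar>int s - s0\<bar> \<le> \<bar>int r - int r0\<bar>"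
      proof
        assume le: "\<bar>int s - s0\<bar> \<le> \<bar>int r - int r0\<bar>"
        then have "r \<noteq> r0" using p by (auto simp: s0_def split: if_splits)
        then have "E r (int s) + E r0 s0 \<le> 1"
          using two p r0 le s0[of s0] by blast
        moreover have "E r0 s0 = 1" using E[of r0 s0] r0 s0[of s0] by auto
        moreover have "0 < E r (int s)" using rs p by (simp add: E)
        ultimately show False by simp
      qed
      then have "\<bar>int r - int r0\<bar> < int s - s0"
        using p by (auto simp: s0_def split: if_splits)
      then show "\<bar>int r - int i\<bar> < int s" using far p by auto
    next
      fix r s r' s' assume rs: "(r, s) \<in># \<pi>" "(r', s') \<in># \<pi>" "(r, s) \<noteq> (r', s')"
      show "\<bar>int r - int r'\<bar> < \<bar>int s - int s'\<bar>"
      proof (rule ccontr)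
        assume le: "\<not> ?thesis"
        then have "r \<noteq> r'" using rs(3) by auto
        then have "E r (int s) + E r' (int s') \<le> 1"
          using two part[OF rs(1)] part[OF rs(2)] le by auto
        moreover have "0 < E r (int s)" "0 < E r' (int s')"
          using rs part[OF rs(1)] part[OF rs(2)] by (simp_all add: E)
        ultimately show False by simp
      qed
    qed simp
    ultimately show "(\<forall>x. count \<pi> x \<le> 1) \<and> set_mset \<pi> \<in> row_chains (2 * l) i" by auto
  next
    assume "(\<forall>x. count \<pi> x \<le> 1) \<and> set_mset \<pi> \<in> row_chains (2 * l) i"
    then have cnt: "count \<pi> x \<le> 1"
      and first: "(r, s) \<in># \<pi> \<Longrightarrow> \<bar>int r - int i\<bar> < int s"
      and sep: "(r, s) \<in># \<pi> \<Longrightarrow> (r', s') \<in># \<pi> \<Longrightarrow> (r, s) \<noteq> (r', s') \<Longrightarrow>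
        \<bar>int r - int r'\<bar> < \<bar>int s - int s'\<bar>" for x r s r' s'
      unfolding row_chains_def by blast+
    \<comment> \<open>Positions on a path differ by at most the row distance, while any two occupied
      positions, the extra entry included, differ by more. So a path meets at most one of
      them.\<close>
    show "admissible ?A l ?k \<pi>"
      unfolding admissible_def k E_def[symmetric]
    proof (intro allI impI sum_le_1_if_single_support)
      fix p a assume "a \<in> ?R"
      then show "E a (p a) \<le> 1" using cnt by (simp add: E)
    next
      fix p a b
      assume p: "downward_path ?A l p" and ab: "a \<in> ?R" "b \<in> ?R" "0 < E a (p a)" "0 < E b (p b)"
      have near: "\<bar>p a - p b\<bar> \<le> \<bar>int a - int b\<bar>"
        using downward_path_abs_diff_le[OF p, of a b] downward_path_abs_diff_le[OF p, of b a] ab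
        by (cases "a \<le> b") auto
      have pos: "p r \<in> positions ?A r" if "r \<in> ?R" for r
        using p that by (auto simp: downward_path_def)
      have occupied: "r = r0 \<and> p r = s0 \<or> 1 \<le> p r \<and> (r, nat (p r)) \<in># \<pi>"
        if "r \<in> ?R" "0 < E r (p r)" for r
        using that E[of r "p r"] s0[of "p r"] pos[of r] by (auto split: if_splits)
      have far_part: "\<bar>int r - int r0\<bar> < p r - s0" if "1 \<le> p r" "(r, nat (p r)) \<in># \<pi>" for r
        using far[of r "nat (p r)"] part[OF that(2)] first[OF that(2)] that(1) by auto
      show "a = b"
      proof (rule ccontr)
        assume "a \<noteq> b"
        then show False
          using occupied[of a] occupied[of b] ab far_part[of a] far_part[of b] near
            sep[of a "nat (p a)" b "nat (p b)"] by auto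
      qed
    qed auto
  qed
qed

text \<open>Multiplicities are at most 1, so an admissible partition is determined by its set of
  parts.\<close>

lemma F_star_eq_card_chains_of:
  assumes "1 \<le> l" and "i \<le> l"
  shows "F_star l i j n = card (chains_of (2 * l) i j n)"
proof -
  let ?P = "{\<pi> \<in> colored_partitions (array_of i) l. weight \<pi> = n \<and> size \<pi> = j \<and>
     admissible (array_of i) l (\<lambda>m. if m = i then 1 else 0) \<pi>}"
  have "bij_betw mset_set (chains_of (2 * l) i j n) ?P"
  proof (rule bij_betw_byWitness[where f' = set_mset])
    show "\<forall>A\<in>chains_of (2 * l) i j n. set_mset (mset_set A) = A"
      by (auto simp: chains_of_def row_chains_def)
    have eq: "mset_set (set_mset \<pi>) = \<pi>" and chain: "set_mset \<pi> \<in> row_chains (2 * l) i" if "\<pi> \<in> ?P" for \<pi>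
    proof -
      have *: "count \<pi> x \<le> 1" "set_mset \<pi> \<in> row_chains (2 * l) i" for x
        using that admissible_unit_iff[OF assms, of \<pi>]
        unfolding colored_partitions_def by blast+
      have "count (mset_set (set_mset \<pi>)) x = count \<pi> x" for x
        using *(1)[of x] by (cases "x \<in># \<pi>") (auto simp: count_eq_zero_iff le_Suc_eq)
      then show "mset_set (set_mset \<pi>) = \<pi>" "set_mset \<pi> \<in> row_chains (2 * l) i"
        using * by (auto intro: multiset_eqI)
    qed
    show "\<forall>\<pi>\<in>?P. mset_set (set_mset \<pi>) = \<pi>" using eq by blast
    have weight: "weight (mset_set A) = sum snd A" for A
      by (simp add: weight_def case_prod_unfold sum_unfold_sum_mset)
    show "mset_set ` chains_of (2 * l) i j n \<subseteq> ?P"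
    proof
      fix \<pi> assume "\<pi> \<in> mset_set ` chains_of (2 * l) i j n"
      then obtain A where A: "A \<in> row_chains (2 * l) i" "card A = j" "sum snd A = n"
        and \<pi>: "\<pi> = mset_set A" by (auto simp: chains_of_def)
      have fin: "finite A" using A by (simp add: row_chains_def)
      have "A \<subseteq> parts (array_of i) l"
      proof
        fix x assume x: "x \<in> A"
        obtain r s where rs: "x = (r, s)" by (cases x)
        have "r \<in> {1..<2 * l} \<and> \<bar>int r - int i\<bar> < int s \<and> odd (r + i + s)"
          using A(1) x unfolding rs row_chains_def by blast
        then show "x \<in> parts (array_of i) l"
          unfolding rs part_parity by auto
      qed
      moreover have "count \<pi> x \<le> 1" for x
        unfolding \<pi> using fin by (cases "x \<in> A") auto
      ultimately show "\<pi> \<in> ?P"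
        using admissible_unit_iff[OF assms, of \<pi>] A fin
        by (auto simp: colored_partitions_def weight \<pi>)
    qed
    show "set_mset ` ?P \<subseteq> chains_of (2 * l) i j n"
    proof (rule image_subsetI)
      fix \<pi> assume \<pi>: "\<pi> \<in> ?P"
      have "card (set_mset \<pi>) = size \<pi>" "sum snd (set_mset \<pi>) = weight \<pi>"
        using eq[OF \<pi>] weight[of "set_mset \<pi>"] by (metis size_mset_set, simp)
      then show "set_mset \<pi> \<in> chains_of (2 * l) i j n"
        using \<pi> chain[OF \<pi>] by (simp add: chains_of_def)
    qed
  qed
  then show ?thesis
    unfolding F_star_def by (simp add: bij_betw_same_card)
qed

theorem theorem1p6:
  fixes l i :: nat
  assumes "2 \<le> l" and "i \<le> l"
  shows "(summand l i has_sum P_star l i) ({1..l} \<rightarrow>\<^sub>E (UNIV :: nat set))"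
proof -
  obtain d where l: "l = Suc d" using assms by (cases l) auto
  have "P_star l i = Abs_fps (\<lambda>j. chain_series (2 * l) i j)"
    using assms by (simp add: P_star_def chain_series_def F_star_eq_card_chains_of)
  \<comment> \<open>As \<open>i \<le> l\<close>, the folding in
    \<open>chain_series_eq_multisum\<close> leaves \<open>i\<close> fixed.\<close>
  also have "\<dots> = Abs_fps (\<lambda>j. q_var ^ j\<^sup>2 * multisum (l - 1) i j)"
    using chain_series_eq_multisum[of i d] assms unfolding l by simp
  finally show ?thesis
    using summand_has_sum[of l i] assms by simp
qed

end
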